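(* Let $G(V,E)$ be a $k$-uniform hypergraph with $k\ge 2$ and $|V|=n$, and let $H\subseteq V$ be a hitting set of $G$. Then $\chi^c(G)\le \left\lceil \log_2 \frac{|H|}{k-1}\right\rceil+1$. Moreover, there is an algorithm that, given $G$ and $H$, computes a bicoloring cover of $G$ of this size in $O\!\left(n\log\frac{|H|}{k-1}\right)$ time.
   Context: A hitting set of $G$ is a set $H\subseteq V$ meeting every hyperedge. A bicoloring is a map $X:V\to\{0,1\}$; a bicoloring cover of $G$ is a set of bicolorings such that every hyperedge is non-monochromatic under at least one of them; $\chi^c(G)$ is the minimum size of a bicoloring cover.
   Formalization: The ceiling of log2(|H|/(k-1)) is replaced by its maximum with 0, as the bound fails e.g. for one edge, k=10, |H|=1; in the running time the logarithm and n are read as at least 1, and empty H gets the bound 1. *)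

theory Defs
  imports Complex_Main "HOL-Library.FuncSet"
begin

definition uniform_hypergraph :: "nat \<Rightarrow> 'a set \<Rightarrow> 'a set set \<Rightarrow> bool" where
  "uniform_hypergraph k V E \<longleftrightarrow> finite V \<and> (\<forall>e\<in>E. e \<subseteq> V \<and> card e = k)"

definition hitting_set :: "'a set \<Rightarrow> 'a set set \<Rightarrow> 'a set \<Rightarrow> bool" where
  "hitting_set V E H \<longleftrightarrow> H \<subseteq> V \<and> (\<forall>e\<in>E. H \<inter> e \<noteq> {})"

text \<open>Bicolorings are extensional functions, so that a set of bicolorings of \<open>V\<close> is counted by
  their values on \<open>V\<close> only.\<close>

definition bicolorings :: "'a set \<Rightarrow> ('a \<Rightarrow> nat) set" where
  "bicolorings V = V \<rightarrow>\<^sub>E {0, 1}"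

definition monochromatic :: "('a \<Rightarrow> nat) \<Rightarrow> 'a set \<Rightarrow> bool" where
  "monochromatic X e \<longleftrightarrow> (\<exists>c. \<forall>v\<in>e. X v = c)"

definition bicoloring_cover :: "'a set \<Rightarrow> 'a set set \<Rightarrow> ('a \<Rightarrow> nat) set \<Rightarrow> bool" where
  "bicoloring_cover V E C \<longleftrightarrow>
     C \<subseteq> bicolorings V \<and> (\<forall>e\<in>E. \<exists>X\<in>C. \<not> monochromatic X e)"

text \<open>For finite \<open>V\<close> every cover is finite, so cardinalities are genuine; a cover exists whenever
  all hyperedges have at least two vertices, so the minimum is attained.\<close>

definition bicoloring_cover_number :: "'a set \<Rightarrow> 'a set set \<Rightarrow> nat" where
  "bicoloring_cover_number V E = (LEAST m. \<exists>C. bicoloring_cover V E C \<and> card C = m)"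

text \<open>
  Model of computation: structured programs for a unit-cost random access machine.  The machine
  has registers, a read-only random-access input, and a read/write memory; all cells hold natural
  numbers.  Every instruction and every test costs one step.  Addition and (truncated) subtraction
  are the only arithmetic operations, so in \<open>t\<close> steps the bit length of any number grows by at
  most \<open>t\<close>; there are no multiplications or shifts with which unit cost could be abused.
\<close>

datatype ram_prog =
    Const nat nat
  | Add nat nat nat
  | Sub nat nat nat
  | Input nat nat
  | Load nat nat
  | Store nat nat
  | Seq ram_prog ram_prog
  | IfPos nat ram_prog ram_prog
  | WhilePos nat ram_prog

text \<open>\<open>exec inp p (R, M) t (R', M')\<close>: started with registers \<open>R\<close> and memory \<open>M\<close> on input \<open>inp\<close>,
  the program \<open>p\<close> halts after exactly \<open>t\<close> steps with registers \<open>R'\<close> and memory \<open>M'\<close>.\<close>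

inductive exec ::
  "(nat \<Rightarrow> nat) \<Rightarrow> ram_prog \<Rightarrow> (nat \<Rightarrow> nat) \<times> (nat \<Rightarrow> nat) \<Rightarrow> nat \<Rightarrow> (nat \<Rightarrow> nat) \<times> (nat \<Rightarrow> nat) \<Rightarrow> bool"
  for inp :: "nat \<Rightarrow> nat" where
  Const: "exec inp (Const r c) (R, M) 1 (R(r := c), M)"
| Add: "exec inp (Add r a b) (R, M) 1 (R(r := R a + R b), M)"
| Sub: "exec inp (Sub r a b) (R, M) 1 (R(r := R a - R b), M)"
| Input: "exec inp (Input r a) (R, M) 1 (R(r := inp (R a)), M)"
| Load: "exec inp (Load r a) (R, M) 1 (R(r := M (R a)), M)"
| Store: "exec inp (Store a b) (R, M) 1 (R, M(R a := R b))"
| Seq: "exec inp p s t s' \<Longrightarrow> exec inp q s' t' s'' \<Longrightarrow> exec inp (Seq p q) s (t + t') s''"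
| IfTrue: "fst s a > 0 \<Longrightarrow> exec inp p s t s' \<Longrightarrow> exec inp (IfPos a p q) s (Suc t) s'"
| IfFalse: "fst s a = 0 \<Longrightarrow> exec inp q s t s' \<Longrightarrow> exec inp (IfPos a p q) s (Suc t) s'"
| WhileTrue: "fst s a > 0 \<Longrightarrow> exec inp p s t s' \<Longrightarrow> exec inp (WhilePos a p) s' t' s'' \<Longrightarrow>
    exec inp (WhilePos a p) s (Suc (t + t')) s''"
| WhileFalse: "fst s a = 0 \<Longrightarrow> exec inp (WhilePos a p) s 1 s"

inductive_cases ConstE: "exec inp (Const r c) s t s'"
inductive_cases AddE: "exec inp (Add r a b) s t s'"
inductive_cases SubE: "exec inp (Sub r a b) s t s'"
inductive_cases InputE: "exec inp (Input r a) s t s'"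
inductive_cases LoadE: "exec inp (Load r a) s t s'"
inductive_cases StoreE: "exec inp (Store a b) s t s'"
inductive_cases SeqE: "exec inp (Seq p q) s t s'"
inductive_cases IfPosE: "exec inp (IfPos a p q) s t s'"
inductive_cases WhilePosE: "exec inp (WhilePos a p) s t s'"

lemma exec_deterministic:
  "exec inp p s t s' \<Longrightarrow> exec inp p s u s'' \<Longrightarrow> u = t \<and> s'' = s'"
proof (induction arbitrary: u s'' rule: exec.induct)
  case (Seq p s t s1 q t' s2)
  from Seq.prems obtain u1 u2 r where "u = u1 + u2" "exec inp p s u1 r" "exec inp q r u2 s''"
    by (rule SeqE)
  with Seq.IH(1)[of u1 r] Seq.IH(2)[of u2 s''] show ?case by simp
next
  case (IfTrue s a p t s' q)
  from IfTrue.prems IfTrue.hyps(1) obtain u1 where "u = Suc u1" "exec inp p s u1 s''"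
    by (elim IfPosE) simp_all
  with IfTrue.IH[of u1 s''] show ?case by simp
next
  case (IfFalse s a q t s' p)
  from IfFalse.prems IfFalse.hyps(1) obtain u1 where "u = Suc u1" "exec inp q s u1 s''"
    by (elim IfPosE) simp_all
  with IfFalse.IH[of u1 s''] show ?case by simp
next
  case (WhileTrue s a p t s1 t' s2)
  from WhileTrue.prems WhileTrue.hyps(1) obtain u1 u2 r where
    "u = Suc (u1 + u2)" "exec inp p s u1 r" "exec inp (WhilePos a p) r u2 s''"
    by - (erule WhilePosE, simp_all)
  with WhileTrue.IH(1)[of u1 r] WhileTrue.IH(2)[of u2 s''] show ?case by simp
next
  case (WhileFalse s a p)
  from WhileFalse.prems WhileFalse.hyps show ?case by - (erule WhilePosE, simp_all)
qed (erule ConstE AddE SubE InputE LoadE StoreE, simp)+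

definition halts_with :: "ram_prog \<Rightarrow> nat list \<Rightarrow> nat \<Rightarrow> (nat \<Rightarrow> nat) \<Rightarrow> bool" where
  "halts_with p xs t M \<longleftrightarrow>
     (\<exists>R. exec (\<lambda>i. if i < length xs then xs ! i else 0) p (\<lambda>_. 0, \<lambda>_. 0) t (R, M))"

text \<open>\<open>xs\<close> encodes a \<open>k\<close>-uniform hypergraph with vertex set \<open>{..<n}\<close> and edge set \<open>E\<close>, together with
  a vertex set \<open>H\<close>: a header, then the vertices of \<open>H\<close>, then the vertices of each hyperedge, where
  vertices and hyperedges are listed in arbitrary order without repetition.\<close>

definition encodes_instance :: "nat \<Rightarrow> nat \<Rightarrow> nat set set \<Rightarrow> nat set \<Rightarrow> nat list \<Rightarrow> bool" where
  "encodes_instance n k E H xs \<longleftrightarrow>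
     (\<exists>hs es. distinct hs \<and> set hs = H \<and>
        (\<forall>e\<in>set es. distinct e) \<and> distinct (map set es) \<and> set ` set es = E \<and>
        xs = [n, k, length hs, length es] @ hs @ concat es)"

text \<open>The memory \<open>M\<close> represents the set \<open>C\<close> of bicolorings of \<open>{..<n}\<close>: cell 0 holds \<open>card C\<close>, and
  the members of \<open>C\<close> follow one after the other, each as a block of \<open>n\<close> cells.\<close>

definition represents_bicolorings :: "nat \<Rightarrow> (nat \<Rightarrow> nat) \<Rightarrow> (nat \<Rightarrow> nat) set \<Rightarrow> bool" where
  "represents_bicolorings n M C \<longleftrightarrow>
     M 0 = card C \<and> C = (\<lambda>i. \<lambda>v\<in>{..<n}. M (1 + i * n + v)) ` {..<M 0}"

end

theory Submission
  imports Defs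
begin

text \<open>
  List \<open>H\<close> as \<open>h\<^sub>0, \<dots>, h\<^sub>m\<^sub>-\<^sub>1\<close> and let \<open>L\<close> be least with \<open>m \<le> (k - 1) 2\<^sup>L\<close>. One bicoloring is the indicator
  of \<open>H\<close>; it handles every hyperedge that leaves \<open>H\<close>. The other \<open>L\<close> bicolorings give \<open>h\<^sub>j\<close> the
  complement of the \<open>i\<close>-th bit of \<open>j\<close>, for \<open>i < L\<close>. At most \<open>k - 1\<close> indices agree in
  their \<open>L\<close> lowest bits, so the \<open>k\<close> vertices of a hyperedge inside \<open>H\<close> are separated by one of them.
  The bicolorings are distinct because only the \<open>i\<close>-th one vanishes at the vertex with index \<open>2\<^sup>i\<close>.
  All of them are runs of \<open>p\<close> equal colors along the list (\<open>p > m\<close> for the indicator, \<open>p = 2\<^sup>i\<close> for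
  the others), so that one pass over \<open>H\<close> with a countdown writes each of them without any division.
\<close>

section \<open>Colorings by runs: they cover, and they are distinct\<close>

definition run_coloring :: "'a list \<Rightarrow> nat \<Rightarrow> 'a \<Rightarrow> nat" where
  "run_coloring hs p v = of_bool (\<exists>j<length hs. hs ! j = v \<and> even (j div p))"

text \<open>\<open>Suc m\<close> instead of \<open>m\<close> keeps the run length positive even for
  an empty list, as the countdown requires.\<close>

definition run_length :: "nat \<Rightarrow> nat \<Rightarrow> nat" where
  "run_length m i = (case i of 0 \<Rightarrow> Suc m | Suc i' \<Rightarrow> 2 ^ i')"

definition run_colorings :: "'a set \<Rightarrow> 'a list \<Rightarrow> nat \<Rightarrow> ('a \<Rightarrow> nat) set" where
  "run_colorings V hs L =
     (\<lambda>i. restrict (run_coloring hs (run_length (length hs) i)) V) ` {..L}"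

lemma run_length_simps [simp]:
  "run_length m 0 = Suc m" "run_length m (Suc i) = 2 ^ i"
  by (simp_all add: run_length_def)

lemma run_coloring_nth:
  "distinct hs \<Longrightarrow> j < length hs \<Longrightarrow> run_coloring hs p (hs ! j) = of_bool (even (j div p))"
  by (auto simp: run_coloring_def nth_eq_iff_index_eq)

lemma run_coloring_notin: "v \<notin> set hs \<Longrightarrow> run_coloring hs p v = 0"
  by (auto simp: run_coloring_def)

text \<open>The parity of \<open>a div 2 ^ i\<close> is binary digit \<open>i\<close> of
  \<open>a\<close>, and the lowest \<open>L\<close> digits determine the residue.\<close>

lemma mod_power2_eqI:
  fixes a b :: nat
  assumes "\<And>i. i < L \<Longrightarrow> even (a div 2 ^ i) = even (b div 2 ^ i)"
  shows "a mod 2 ^ L = b mod 2 ^ L"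
proof -
  have "bit a i = bit b i" if "i < L" for i
    using assms[OF that] by (simp add: bit_iff_odd)
  then have "take_bit L a = take_bit L b"
    by (intro bit_eqI) (auto simp: bit_take_bit_iff)
  then show ?thesis by (simp add: take_bit_eq_mod)
qed

text \<open>Numbers with a common residue are told apart by their quotients, which take at most
  \<open>q\<close> values.\<close>

lemma card_residue_class_le:
  fixes J :: "nat set"
  assumes "\<And>j. j \<in> J \<Longrightarrow> j < q * d" and "\<And>j j'. j \<in> J \<Longrightarrow> j' \<in> J \<Longrightarrow> j mod d = j' mod d"
  shows "card J \<le> q"
proof -
  have "inj_on (\<lambda>j. j div d) J"
    by (rule inj_onI) (metis assms(2) div_mult_mod_eq)
  moreover have "(\<lambda>j. j div d) ` J \<subseteq> {..<q}"
    using assms(1) by (auto intro: less_mult_imp_div_less)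
  ultimately have "card J \<le> card {..<q}" by (rule card_inj_on_le) simp
  then show ?thesis by simp
qed

lemma run_colorings_cover:
  assumes k: "k \<ge> 2" and G: "uniform_hypergraph k V E" and H: "hitting_set V E (set hs)"
    and hs: "distinct hs" and L: "length hs \<le> (k - 1) * 2 ^ L"
  shows "bicoloring_cover V E (run_colorings V hs L)"
  unfolding bicoloring_cover_def
proof (intro conjI ballI)
  show "run_colorings V hs L \<subseteq> bicolorings V"
    by (auto simp: run_colorings_def bicolorings_def run_coloring_def)
  fix e assume e: "e \<in> E"
  then have eV: "e \<subseteq> V" and card_e: "card e = k" and hit: "set hs \<inter> e \<noteq> {}"
    using G H by (auto simp: uniform_hypergraph_def hitting_set_def)
  show "\<exists>X\<in>run_colorings V hs L. \<not> monochromatic X e"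
  proof (rule ccontr)
    assume no: "\<not> ?thesis"
    have same: "run_coloring hs (run_length (length hs) i) x
                   = run_coloring hs (run_length (length hs) i) y"
      if "i \<le> L" "x \<in> e" "y \<in> e" for i x y
    proof -
      have "restrict (run_coloring hs (run_length (length hs) i)) V \<in> run_colorings V hs L"
        using that(1) by (auto simp: run_colorings_def)
      then have "monochromatic (restrict (run_coloring hs (run_length (length hs) i)) V) e"
        using no by blast
      then show ?thesis
        using that(2,3) eV unfolding monochromatic_def by (metis restrict_apply' subsetD)
    qed
    from hit obtain j where j: "j < length hs" "hs ! j \<in> e" by (auto simp: in_set_conv_nth)
    have sub: "e \<subseteq> set hs"
    proof
      fix y assume y: "y \<in> e"
      \<comment> \<open>With runs longer than the list, this coloring is the indicator of
        \<open>set hs\<close>; being 1 at \<open>hs ! j\<close>, it is 1 on all of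
        \<open>e\<close>.\<close>
      have "run_coloring hs (Suc (length hs)) y = 1"
        using same[of 0, OF _ j(2) y] j hs by (simp add: run_coloring_nth)
      then show "y \<in> set hs" using run_coloring_notin by fastforce
    qed
    define J where "J = {j. j < length hs \<and> hs ! j \<in> e}"
    have "e = (!) hs ` J" using sub unfolding J_def by (fastforce simp: in_set_conv_nth)
    then have "k \<le> card J" using card_e card_image_le[of J "(!) hs"] by (simp add: J_def)
    also have "card J \<le> k - 1"
    proof (rule card_residue_class_le)
      show "j < (k - 1) * 2 ^ L" if "j \<in> J" for j using that L by (simp add: J_def)
      show "j mod 2 ^ L = j' mod 2 ^ L" if "j \<in> J" "j' \<in> J" for j j'
      proof (rule mod_power2_eqI)
        fix i assume "i < L"
        then have "run_coloring hs (2 ^ i) (hs ! j) = run_coloring hs (2 ^ i) (hs ! j')"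
          using same[of "Suc i" "hs ! j" "hs ! j'"] that by (simp add: J_def)
        with that hs show "even (j div 2 ^ i) = even (j' div 2 ^ i)"
          by (simp add: J_def run_coloring_nth of_bool_def split: if_splits)
      qed
    qed
    finally show False using k by simp
  qed
qed

text \<open>The output must announce the exact number of colorings, so repetitions have to be
  excluded. The bound on \<open>2 ^ i\<close> makes the separating vertex
  \<open>hs ! (2 ^ i)\<close> exist.\<close>

lemma card_run_colorings:
  assumes hs: "distinct hs" "set hs \<subseteq> V" and L: "\<And>i. i < L \<Longrightarrow> 2 ^ i < length hs"
  shows "card (run_colorings V hs L) = Suc L"
proof -
  have neq: "restrict (run_coloring hs (run_length (length hs) i)) V
      \<noteq> restrict (run_coloring hs (run_length (length hs) (Suc i'))) V"
    if "i' < L" "i \<noteq> Suc i'" for i i'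
  proof -
    have len: "2 ^ i' < length hs" using L that(1) .
    \<comment> \<open>The quotient is 0 for a longer run and a positive power of 2 for a shorter
      one; equal run lengths are excluded.\<close>
    have "even ((2::nat) ^ i' div run_length (length hs) i)"
    proof (cases i)
      case (Suc i'')
      with that consider "i' < i''" | "i'' < i'" by (metis nat_neq_iff)
      then show ?thesis
      proof cases
        case 2
        then have "(2::nat) ^ i' div 2 ^ i'' = 2 ^ (i' - i'')" by (simp add: power_diff)
        with 2 Suc show ?thesis by simp
      qed (simp add: Suc)
    qed (use len in simp)
    then have "run_coloring hs (run_length (length hs) i) (hs ! (2 ^ i')) = 1"
      and "run_coloring hs (run_length (length hs) (Suc i')) (hs ! (2 ^ i')) = 0"
      using len hs by (simp_all add: run_coloring_nth)
    moreover have "hs ! (2 ^ i') \<in> V" using len hs by auto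
    ultimately show ?thesis by (metis restrict_apply' zero_neq_one)
  qed
  have "inj_on (\<lambda>i. restrict (run_coloring hs (run_length (length hs) i)) V) {..L}"
  proof (rule inj_onI, rule ccontr)
    fix a b
    assume ab: "a \<in> {..L}" "b \<in> {..L}" "a \<noteq> b"
      and eq: "restrict (run_coloring hs (run_length (length hs) a)) V
        = restrict (run_coloring hs (run_length (length hs) b)) V"
    show False
    proof (cases a)
      case 0
      with ab obtain b' where "b = Suc b'" by (cases b) auto
      with neq[of b' a] ab eq show False by simp
    next
      case (Suc a')
      with neq[of a' b] ab eq show False by simp
    qed
  qed
  then show ?thesis by (simp add: run_colorings_def card_image)
qed

section \<open>Repeated doubling as a rounded logarithm, and the bound on the cover number\<close>

definition doublings :: "nat \<Rightarrow> nat \<Rightarrow> nat" where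
  "doublings m q = (LEAST i. m \<le> q * 2 ^ i)"

lemma le_doublings: "q > 0 \<Longrightarrow> m \<le> q * 2 ^ doublings m q"
  unfolding doublings_def
\<comment> \<open>The witness \<open>m\<close> works since \<open>m < 2 ^ m\<close>.\<close>
proof (rule LeastI[of _ m])
  assume "q > 0"
  then have "1 * m \<le> q * 2 ^ m" by (intro mult_le_mono) (auto intro: less_imp_le)
  then show "m \<le> q * 2 ^ m" by simp
qed

lemma less_doublings: "i < doublings m q \<Longrightarrow> q * 2 ^ i < m"
  unfolding doublings_def using not_less_Least not_le by blast

text \<open>A least natural exponent is the ceiling of the logarithm cut off at 0; the cut matters
  once the logarithm is at most -1.\<close>

lemma doublings_eq_log:
  assumes q: "q > 0"
  shows "int (doublings m q) = max 0 \<lceil>log 2 (real m / real q)\<rceil>"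
proof (cases "m = 0")
  case True
  then show ?thesis by (simp add: doublings_def log_def Least_equality)
next
  case False
  let ?x = "log 2 (real m / real q)"
  have iff: "?x \<le> real i \<longleftrightarrow> m \<le> q * 2 ^ i" for i
  proof -
    have "?x \<le> real i \<longleftrightarrow> real m / real q \<le> 2 powr real i"
      using False q by (subst log_le_iff) auto
    also have "\<dots> \<longleftrightarrow> real m \<le> real (q * 2 ^ i)"
      using q by (simp add: powr_realpow field_simps)
    finally show ?thesis by (simp only: of_nat_le_iff)
  qed
  have "doublings m q = nat \<lceil>?x\<rceil>"
    unfolding doublings_def
  proof (rule Least_equality)
    show "m \<le> q * 2 ^ nat \<lceil>?x\<rceil>" unfolding iff[symmetric] by linarith
    show "nat \<lceil>?x\<rceil> \<le> i" if "m \<le> q * 2 ^ i" for i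
      using that unfolding iff[symmetric] by linarith
  qed
  then show ?thesis by simp
qed

lemma card_run_colorings_doublings:
  assumes "distinct hs" "set hs \<subseteq> V" "q > 0"
  shows "card (run_colorings V hs (doublings (length hs) q)) = Suc (doublings (length hs) q)"
proof (rule card_run_colorings[OF assms(1,2)])
  fix i assume "i < doublings (length hs) q"
  then have "q * 2 ^ i < length hs" by (rule less_doublings)
  moreover have "1 * 2 ^ i \<le> q * 2 ^ i" using assms(3) by (intro mult_le_mono) auto
  ultimately show "2 ^ i < length hs" by linarith
qed

lemma bicoloring_cover_number_le:
  assumes k: "k \<ge> 2" and G: "uniform_hypergraph k V E" and H: "hitting_set V E H"
  shows "int (bicoloring_cover_number V E)
    \<le> max 0 \<lceil>log 2 (real (card H) / (real k - 1))\<rceil> + 1"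
proof -
  have HV: "H \<subseteq> V" and "finite H"
    using G H by (auto simp: uniform_hypergraph_def hitting_set_def intro: finite_subset)
  then obtain hs where hs: "set hs = H" "distinct hs" using finite_distinct_list by blast
  then have len: "length hs = card H" using distinct_card by metis
  define L where "L = doublings (card H) (k - 1)"
  have "bicoloring_cover V E (run_colorings V hs L)"
    using k G H hs by (intro run_colorings_cover) (auto simp: L_def len le_doublings)
  moreover have "card (run_colorings V hs L) = Suc L"
    using k HV hs card_run_colorings_doublings[of hs V "k - 1"] by (simp add: L_def len)
  ultimately have "bicoloring_cover_number V E \<le> Suc L"
    unfolding bicoloring_cover_number_def by (intro Least_le) blast
  then show ?thesis
    using k doublings_eq_log[of "k - 1" "card H"] by (simp add: L_def of_nat_diff)
qed


section \<open>Timed weakest preconditions\<close>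

text \<open>A halting run has to exist, so this is total correctness. The step count goes to the
  postcondition, so that costs add up while rules are chained.\<close>

definition wp ::
  "(nat \<Rightarrow> nat) \<Rightarrow> ram_prog \<Rightarrow> (nat \<Rightarrow> (nat \<Rightarrow> nat) \<times> (nat \<Rightarrow> nat) \<Rightarrow> bool)
    \<Rightarrow> (nat \<Rightarrow> nat) \<times> (nat \<Rightarrow> nat) \<Rightarrow> bool" where
  "wp inp p Q s \<longleftrightarrow> (\<exists>t s'. exec inp p s t s' \<and> Q t s')"

lemma wp_mono: "wp inp p Q s \<Longrightarrow> (\<And>t s'. Q t s' \<Longrightarrow> Q' t s') \<Longrightarrow> wp inp p Q' s"
  unfolding wp_def by blast

lemma wp_basic:
  "Q 1 (R(r := c), M) \<Longrightarrow> wp inp (Const r c) Q (R, M)"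
  "Q 1 (R(r := R a + R b), M) \<Longrightarrow> wp inp (Add r a b) Q (R, M)"
  "Q 1 (R(r := R a - R b), M) \<Longrightarrow> wp inp (Sub r a b) Q (R, M)"
  "Q 1 (R(r := inp (R a)), M) \<Longrightarrow> wp inp (Input r a) Q (R, M)"
  "Q 1 (R, M(R a := R b)) \<Longrightarrow> wp inp (Store a b) Q (R, M)"
  unfolding wp_def by (blast intro: exec.intros)+

lemma wp_Seq:
  "wp inp p (\<lambda>t. wp inp q (\<lambda>t'. Q (t + t'))) s \<Longrightarrow> wp inp (Seq p q) Q s"
  unfolding wp_def by (blast intro: exec.intros)

lemma wp_IfPos:
  assumes "R a > 0 \<Longrightarrow> wp inp p (\<lambda>t. Q (Suc t)) (R, M)"
    and "R a = 0 \<Longrightarrow> wp inp q (\<lambda>t. Q (Suc t)) (R, M)"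
  shows "wp inp (IfPos a p q) Q (R, M)"
proof (cases "R a = 0")
  case True
  with assms(2) obtain t s' where "exec inp q (R, M) t s'" "Q (Suc t) s'"
    unfolding wp_def by blast
  moreover have "fst (R, M) a = 0" using True by simp
  ultimately show ?thesis unfolding wp_def by (metis exec.IfFalse)
next
  case False
  with assms(1) obtain t s' where "exec inp p (R, M) t s'" "Q (Suc t) s'"
    unfolding wp_def by blast
  moreover have "fst (R, M) a > 0" using False by simp
  ultimately show ?thesis unfolding wp_def by (metis exec.IfTrue)
qed

text \<open>The invariant is indexed by the rounds already done, out of a number \<open>N\<close>
  known in advance. Each round costs its body and one test; the last test adds 1.\<close>

lemma wp_WhilePos:
  assumes step: "\<And>i s. i < N \<Longrightarrow> I i s \<Longrightarrow> fst s a > 0 \<and> wp inp p (\<lambda>t s'. t \<le> B \<and> I (Suc i) s') s"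
    and final: "\<And>s. I N s \<Longrightarrow> fst s a = 0"
    and init: "I 0 s"
  shows "wp inp (WhilePos a p) (\<lambda>t s'. t \<le> N * Suc B + 1 \<and> I N s') s"
proof -
  have "\<exists>t s'. exec inp (WhilePos a p) s t s' \<and> t \<le> (N - i) * Suc B + 1 \<and> I N s'"
    if "i \<le> N" "I i s" for i s
    using that
  proof (induction i arbitrary: s rule: inc_induct)
    case base
    then have "exec inp (WhilePos a p) s 1 s" by (intro exec.WhileFalse final)
    with base show ?case by (intro exI[of _ 1] exI[of _ s]) simp
  next
    case (step i)
    from assms(1)[OF step.hyps(2) step.prems] obtain t s1 where
      1: "fst s a > 0" "exec inp p s t s1" "t \<le> B" "I (Suc i) s1"
      unfolding wp_def by blast
    from step.IH[OF 1(4)] obtain t' s' where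
      2: "exec inp (WhilePos a p) s1 t' s'" "t' \<le> (N - Suc i) * Suc B + 1" "I N s'" by blast
    have "N - i = Suc (N - Suc i)" using step.hyps by simp
    then have "Suc (t + t') \<le> (N - i) * Suc B + 1" using 1(3) 2(2) by simp
    with exec.WhileTrue[OF 1(1,2) 2(1)] 2(3) show ?case by blast
  qed
  from this[of 0 s] init show ?thesis by (simp add: wp_def)
qed


section \<open>The program\<close>

text \<open>
  Registers: 0 holds 0; 1 holds 1; 2 is \<open>n\<close>; 3 is \<open>m = |H|\<close>; 4 is the start of the current block
  of memory; 5 counts the bicolorings; 6 is the run length \<open>p\<close>; 7 is \<open>(k - 1) 2\<^sup>i\<close>; 8 is \<open>m\<close> minus
  register 7; 9 is the current color; 10 is the number of further vertices in the current run; 11 is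
  the input position; 12 is the number of vertices of \<open>H\<close> still to be colored; 13 is scratch.
\<close>

definition color_vertex :: ram_prog where
  "color_vertex =
     Seq (Input 13 11) (Seq (Add 13 13 4) (Seq (Store 13 9)
    (Seq (Add 11 11 1) (Seq (Sub 12 12 1)
    (IfPos 10 (Sub 10 10 1) (Seq (Sub 9 1 9) (Sub 10 6 1)))))))"

text \<open>The list of \<open>H\<close> starts at input position 4, behind the header. Vertices
  outside \<open>H\<close> need no write, since the memory is initially 0; this keeps the cost
  linear in \<open>|H|\<close>.\<close>

definition write_coloring :: ram_prog where
  "write_coloring =
     Seq (Const 9 1) (Seq (Sub 10 6 1) (Seq (Const 11 4) (Seq (Add 12 3 0)
    (WhilePos 12 color_vertex))))"

text \<open>Doubling registers 6 and 7 together replaces powers and products. The truncated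
  difference in register 8 is positive exactly as long as a further bicoloring is due.\<close>

definition next_coloring :: ram_prog where
  "next_coloring =
     Seq (Add 4 4 2) (Seq (Add 5 5 1) (Seq write_coloring
    (Seq (Add 6 6 6) (Seq (Add 7 7 7) (Sub 8 3 7)))))"

text \<open>Only \<open>n\<close>, \<open>k\<close>, \<open>|H|\<close> and the list of
  \<open>H\<close> are read, so the time does not depend on the number of hyperedges. The indicator
  is written before the loop.\<close>

definition cover_prog :: ram_prog where
  "cover_prog =
     Seq (Const 1 1) (Seq (Input 2 0) (Seq (Input 7 1) (Seq (Sub 7 7 1)
    (Seq (Const 3 2) (Seq (Input 3 3) (Seq (Const 4 1) (Seq (Const 5 1)
    (Seq (Add 6 3 1) (Seq write_coloring (Seq (Const 6 1) (Seq (Sub 8 3 7)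
    (Seq (WhilePos 8 next_coloring) (Store 0 5)))))))))))))"

section \<open>Correctness and running time of the program\<close>

lemma div_mod_Suc_cases:
  fixes j p :: nat
  assumes "p > 0"
  shows "p - 1 - j mod p > 0 \<Longrightarrow> Suc j div p = j div p \<and> Suc j mod p = Suc (j mod p)"
    and "p - 1 - j mod p = 0 \<Longrightarrow> Suc j div p = Suc (j div p) \<and> Suc j mod p = 0"
proof -
  have "j mod p < p" using assms by simp
  then show "p - 1 - j mod p > 0 \<Longrightarrow> Suc j div p = j div p \<and> Suc j mod p = Suc (j mod p)"
    and "p - 1 - j mod p = 0 \<Longrightarrow> Suc j div p = Suc (j div p) \<and> Suc j mod p = 0"
    by (auto simp: div_Suc mod_Suc)
qed

text \<open>A vertex takes at most 8 steps and its loop test 1; the setup and the last test give 5.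
  The claim on \<open>v\<close> extends beyond the block, so that later cells can be shown to be
  still 0.\<close>

lemma wp_write_coloring:
  assumes hs: "distinct hs" "\<And>j. j < length hs \<Longrightarrow> inp (4 + j) = hs ! j"
    and R: "R 0 = 0" "R (Suc 0) = 1" "R 3 = length hs" "R 6 > 0"
    and M: "\<And>v. M (R 4 + v) = 0"
  shows "wp inp write_coloring
    (\<lambda>t s. t \<le> 9 * length hs + 5 \<and> (\<forall>x\<le>8. fst s x = R x) \<and> (\<forall>x<R 4. snd s x = M x) \<and>
       (\<forall>v. snd s (R 4 + v) = run_coloring hs (R 6) v)) (R, M)"
proof -
  let ?p = "R 6"
  define I where "I j s \<longleftrightarrow> (\<forall>x\<le>8. fst s x = R x) \<and> (\<forall>x<R 4. snd s x = M x) \<and>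
    (\<forall>v. snd s (R 4 + v) = of_bool (\<exists>j'<j. hs ! j' = v \<and> even (j' div ?p))) \<and>
    fst s 9 = of_bool (even (j div ?p)) \<and> fst s 10 = ?p - 1 - j mod ?p \<and>
    fst s 11 = 4 + j \<and> fst s 12 = length hs - j" for j s
  have loop: "wp inp (WhilePos 12 color_vertex)
      (\<lambda>t s. t \<le> length hs * Suc 8 + 1 \<and> I (length hs) s)
      (R(9 := 1, 10 := ?p - 1, 11 := 4, 12 := length hs), M)"
  proof (rule wp_WhilePos)
    show "fst s 12 = 0" if "I (length hs) s" for s using that by (simp add: I_def)
    show "I 0 (R(9 := 1, 10 := ?p - 1, 11 := 4, 12 := length hs), M)"
      using M by (simp add: I_def)
    fix j s assume j: "j < length hs" and I: "I j s"
    obtain S N where s: "s = (S, N)" by force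
    have frame: "S x = R x" if "x \<le> 8" for x using I that by (simp add: I_def s)
    have S: "S (Suc 0) = 1" "S 4 = R 4" "S 6 = ?p" using R frame by simp_all
    have S': "S 9 = of_bool (even (j div ?p))" "S 10 = ?p - 1 - j mod ?p" "S 11 = 4 + j"
      "S 12 = length hs - j" using I by (simp_all add: I_def s)
    define N' where "N' = N(R 4 + hs ! j := of_bool (even (j div ?p)))"
    have "N (R 4 + v) = of_bool (\<exists>j'<j. hs ! j' = v \<and> even (j' div ?p))" for v
      using I by (simp add: I_def s)
    \<comment> \<open>Since \<open>hs\<close> is distinct, the store never overwrites the color of
      an earlier vertex.\<close>
    then have new: "N' (R 4 + v) = of_bool (\<exists>j'<Suc j. hs ! j' = v \<and> even (j' div ?p))" for v
      using hs(1) j by (auto simp: N'_def less_Suc_eq nth_eq_iff_index_eq)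
    have old: "N' x = M x" if "x < R 4" for x
      using I that by (simp add: I_def s N'_def)
    have mem: "N(inp (S 11) + S 4 := S 9) = N'"
      using hs(2)[OF j] by (simp add: N'_def S S' add.commute)
    have "wp inp color_vertex (\<lambda>t s'. t \<le> 8 \<and> I (Suc j) s') (S, N)"
      unfolding color_vertex_def
      \<comment> \<open>Register 10 holds \<open>p - 1 - j mod p\<close>. While it is positive the
        quotient \<open>j div p\<close> stays; at 0 the next index has a quotient larger by 1, so
        the color flips.\<close>
      using div_mod_Suc_cases[OF R(4), of j]
      by (intro wp_Seq wp_basic wp_IfPos)
        (simp_all add: mem, simp_all add: I_def S S' new old frame)
    then show "fst s 12 > 0 \<and> wp inp color_vertex (\<lambda>t s'. t \<le> 8 \<and> I (Suc j) s') s"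
      using j S' by (simp add: s)
  qed
  have "wp inp (WhilePos 12 color_vertex)
      (\<lambda>t s. t \<le> 9 * length hs + 1 \<and> (\<forall>x\<le>8. fst s x = R x) \<and> (\<forall>x<R 4. snd s x = M x) \<and>
         (\<forall>v. snd s (R 4 + v) = run_coloring hs ?p v))
      (R(9 := 1, 10 := ?p - 1, 11 := 4, 12 := length hs), M)"
    by (rule wp_mono[OF loop]) (simp add: I_def run_coloring_def)
  then show ?thesis
    unfolding write_coloring_def by (intro wp_Seq wp_basic) (simp add: R)
qed

text \<open>Blank memory behind the finished blocks is what the next call expects. Cell 0 is left
  out because it receives the count at the end.\<close>

definition blocks :: "nat list \<Rightarrow> nat \<Rightarrow> nat \<Rightarrow> (nat \<Rightarrow> nat) \<Rightarrow> bool" where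
  "blocks hs n i M \<longleftrightarrow>
     (\<forall>i'<i. \<forall>v<n. M (1 + i' * n + v) = run_coloring hs (run_length (length hs) i') v) \<and>
     (\<forall>v. M (1 + i * n + v) = 0)"

lemma blocks_Suc:
  assumes "blocks hs n i M" and "set hs \<subseteq> {..<n}"
    and same: "\<And>x. x < 1 + i * n \<Longrightarrow> M' x = M x"
    and new: "\<And>v. M' (1 + i * n + v) = run_coloring hs (run_length (length hs) i) v"
  shows "blocks hs n (Suc i) M'"
  unfolding blocks_def
proof (intro conjI allI impI)
  fix i' v assume i': "i' < Suc i" and v: "v < n"
  show "M' (1 + i' * n + v) = run_coloring hs (run_length (length hs) i') v"
  proof (cases "i' = i")
    case False
    then have "Suc i' * n \<le> i * n" using i' by (intro mult_le_mono) auto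
    then have "1 + i' * n + v < 1 + i * n" using v by simp
    then show ?thesis using same False i' v assms(1) by (simp add: blocks_def)
  qed (simp add: new[simplified])
next
  fix v
  \<comment> \<open>Cells from the next block on belong to numbers \<open>n + v\<close>, which are
    outside \<open>H\<close> and hence have color 0.\<close>
  have "n + v \<notin> set hs" using assms(2) by auto
  then show "M' (1 + Suc i * n + v) = 0"
    using new[of "n + v"] by (simp add: run_coloring_notin ac_simps)
qed

lemma wp_write_block:
  assumes hs: "distinct hs" "set hs \<subseteq> {..<n}" "\<And>j. j < length hs \<Longrightarrow> inp (4 + j) = hs ! j"
    and R: "R 0 = 0" "R (Suc 0) = 1" "R 3 = length hs" "R 4 = 1 + i * n"
      "R 6 = run_length (length hs) i"
    and M: "blocks hs n i M"
    and Q: "\<And>t S N. t \<le> 9 * length hs + 5 \<Longrightarrow> (\<And>x. x \<le> 8 \<Longrightarrow> S x = R x) \<Longrightarrow>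
      blocks hs n (Suc i) N \<Longrightarrow> Q t (S, N)"
  shows "wp inp write_coloring Q (R, M)"
proof (rule wp_mono)
  show "wp inp write_coloring
    (\<lambda>t s. t \<le> 9 * length hs + 5 \<and> (\<forall>x\<le>8. fst s x = R x) \<and> (\<forall>x<R 4. snd s x = M x) \<and>
       (\<forall>v. snd s (R 4 + v) = run_coloring hs (R 6) v)) (R, M)"
    using R M by (intro wp_write_coloring hs(1,3)) (auto simp: blocks_def run_length_def split: nat.split)
next
  fix t s
  assume *: "t \<le> 9 * length hs + 5 \<and> (\<forall>x\<le>8. fst s x = R x) \<and> (\<forall>x<R 4. snd s x = M x) \<and>
    (\<forall>v. snd s (R 4 + v) = run_coloring hs (R 6) v)"
  obtain S N where s: "s = (S, N)" by force
  have "blocks hs n (Suc i) N"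
    using * R by (intro blocks_Suc[OF M hs(2)]) (simp_all add: s)
  with * Q[of t S N] show "Q t s" by (simp add: s)
qed

text \<open>With \<open>m\<close> for \<open>length hs\<close>: 9 setup steps,
  \<open>9 * m + 5\<close> for the indicator, 2 more steps, the last test and the final store make
  \<open>9 * m + 18\<close>. A round costs \<open>9 * m + 10\<close> and its test.\<close>

lemma wp_cover_prog:
  fixes hs :: "nat list"
  assumes k: "k \<ge> 2" and hs: "distinct hs" "set hs \<subseteq> {..<n}"
    and inp: "inp 0 = n" "inp (Suc 0) = k" "inp 2 = length hs"
      "\<And>j. j < length hs \<Longrightarrow> inp (4 + j) = hs ! j"
  defines "L \<equiv> doublings (length hs) (k - 1)"
  shows "wp inp cover_prog
    (\<lambda>t s. t \<le> 9 * length hs + 18 + L * (9 * length hs + 11) \<and> snd s 0 = Suc L \<and>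
       (\<forall>i\<le>L. \<forall>v<n. snd s (1 + i * n + v) = run_coloring hs (run_length (length hs) i) v))
    (\<lambda>_. 0, \<lambda>_. 0)"
proof -
  define m where "m = length hs"
  \<comment> \<open>After \<open>i\<close> rounds \<open>i + 1\<close> blocks are written, counting
    the indicator, and register 4 still points at the last one.\<close>
  define I where "I i s \<longleftrightarrow> fst s 0 = 0 \<and> fst s (Suc 0) = 1 \<and> fst s 2 = n \<and> fst s 3 = m \<and>
    fst s 4 = 1 + i * n \<and> fst s 5 = Suc i \<and> fst s 6 = 2 ^ i \<and> fst s 7 = (k - 1) * 2 ^ i \<and>
    fst s 8 = m - (k - 1) * 2 ^ i \<and> blocks hs n (Suc i) (snd s)" for i s
  have loop: "wp inp (WhilePos 8 next_coloring) (\<lambda>t s. t \<le> L * Suc (9 * m + 10) + 1 \<and> I L s) s"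
    if "I 0 s" for s
  proof (rule wp_WhilePos[where I = I])
    show "I 0 s" by fact
    show "fst s 8 = 0" if "I L s" for s
      using that le_doublings[of "k - 1" m] k by (simp add: I_def L_def m_def)
    fix i s assume i: "i < L" and I: "I i s"
    obtain S N where s: "s = (S, N)" by force
    have S: "S 0 = 0" "S (Suc 0) = 1" "S 2 = n" "S 3 = m" "S 4 = 1 + i * n" "S 5 = Suc i"
      "S 6 = 2 ^ i" "S 7 = (k - 1) * 2 ^ i" "S 8 = m - (k - 1) * 2 ^ i"
      and N: "blocks hs n (Suc i) N" using I by (simp_all add: I_def s)
    have "wp inp next_coloring (\<lambda>t s'. t \<le> 9 * m + 10 \<and> I (Suc i) s') (S, N)"
      unfolding next_coloring_def
      by (intro wp_Seq wp_basic wp_write_block[OF hs inp(4), where i = "Suc i"])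
        (use N in \<open>simp_all add: S m_def I_def mult_2 algebra_simps\<close>)
    moreover have "S 8 > 0" using less_doublings[of i m "k - 1"] i by (simp add: S L_def m_def)
    ultimately show "fst s 8 > 0 \<and> wp inp next_coloring (\<lambda>t s'. t \<le> 9 * m + 10 \<and> I (Suc i) s') s"
      by (simp add: s)
  qed
  \<comment> \<open>The two time arguments of \<open>Q\<close> belong to the loop and to the final
    store, which leaves the blocks from cell 1 on intact.\<close>
  have rest: "wp inp (WhilePos 8 next_coloring) (\<lambda>t. wp inp (Store 0 5) (Q t)) (S, N)"
    if "I 0 (S, N)" and Q: "\<And>t s. t \<le> L * (9 * m + 11) + 1 \<Longrightarrow> snd s 0 = Suc L \<Longrightarrow>
      \<forall>i\<le>L. \<forall>v<n. snd s (1 + i * n + v) = run_coloring hs (run_length (length hs) i) v \<Longrightarrow>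
      Q t 1 s" for Q S N
  proof (rule wp_mono[OF loop[OF that(1)]])
    fix t s assume *: "t \<le> L * Suc (9 * m + 10) + 1 \<and> I L s"
    obtain S N where s: "s = (S, N)" by force
    show "wp inp (Store 0 5) (Q t) s"
      unfolding s using * by (intro wp_basic Q) (simp_all add: s I_def blocks_def add.commute)
  qed
  show ?thesis
    unfolding cover_prog_def
    by (intro wp_Seq wp_basic wp_write_block[OF hs inp(4), where i = 0] rest)
      (simp_all add: inp m_def I_def, simp add: blocks_def)
qed

lemma represents_run_colorings:
  assumes "M 0 = Suc L" and "card (run_colorings {..<n} hs L) = Suc L"
    and "\<And>i v. i \<le> L \<Longrightarrow> v < n \<Longrightarrow> M (1 + i * n + v) = run_coloring hs (run_length (length hs) i) v"
  shows "represents_bicolorings n M (run_colorings {..<n} hs L)"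
proof -
  have "run_colorings {..<n} hs L = (\<lambda>i. \<lambda>v\<in>{..<n}. M (1 + i * n + v)) ` {..<M 0}"
    unfolding run_colorings_def assms(1) lessThan_Suc_atMost
    by (intro image_cong refl restrict_ext) (simp only: assms(3) atMost_iff lessThan_iff)
  with assms(1,2) show ?thesis by (simp add: represents_bicolorings_def)
qed

lemma cover_prog_correct:
  assumes k: "k \<ge> 2" and G: "uniform_hypergraph k {..<n} E" and H: "hitting_set {..<n} E H"
    and "encodes_instance n k E H xs"
  shows "\<exists>t M C. halts_with cover_prog xs t M \<and> represents_bicolorings n M C \<and>
      bicoloring_cover {..<n} E C \<and>
      int (card C) = max 0 \<lceil>log 2 (real (card H) / (real k - 1))\<rceil> + 1 \<and>
      real t \<le> 90 * (real (max 1 n) * max 1 (log 2 (real (card H) / (real k - 1))))"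
proof -
  from assms(4) obtain hs es where hs: "distinct hs" "set hs = H"
    and xs: "xs = [n, k, length hs, length es] @ hs @ concat es"
    unfolding encodes_instance_def by (elim exE conjE)
  have HV: "set hs \<subseteq> {..<n}" using H hs by (simp add: hitting_set_def)
  have len: "length hs = card H" using hs distinct_card by metis
  define L where "L = doublings (length hs) (k - 1)"
  have L: "int L = max 0 \<lceil>log 2 (real (card H) / (real k - 1))\<rceil>"
    using k doublings_eq_log[of "k - 1" "length hs"] by (simp add: L_def len)
  let ?inp = "\<lambda>i. if i < length xs then xs ! i else 0"
  have "?inp 0 = n" "?inp (Suc 0) = k" "?inp 2 = length hs"
    "\<And>j. j < length hs \<Longrightarrow> ?inp (4 + j) = hs ! j"
    by (simp_all add: xs nth_append)
  from wp_cover_prog[where inp = ?inp, OF k hs(1) HV this, folded L_def]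
  obtain t R M where run: "exec ?inp cover_prog (\<lambda>_. 0, \<lambda>_. 0) t (R, M)"
    and t: "t \<le> 9 * length hs + 18 + L * (9 * length hs + 11)"
    and M: "M 0 = Suc L" "\<And>i v. i \<le> L \<Longrightarrow> v < n \<Longrightarrow>
      M (1 + i * n + v) = run_coloring hs (run_length (length hs) i) v"
    unfolding wp_def by auto
  have card: "card (run_colorings {..<n} hs L) = Suc L"
    unfolding L_def using k by (intro card_run_colorings_doublings hs HV) simp
  let ?N = "max 1 n" and ?l = "max 1 (log 2 (real (card H) / (real k - 1)))"
  have "card H \<le> n" using card_mono[OF _ HV] hs by simp
  then have "9 * length hs + 18 \<le> ?N * 29" "9 * length hs + 11 \<le> ?N * 20"
    by (simp_all add: len)
  then have "t \<le> ?N * 29 + L * (?N * 20)"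
    using t by (meson add_mono mult_le_mono2 order_trans)
  then have "t \<le> ?N * (29 + 20 * L)" by (simp add: algebra_simps)
  then have "real t \<le> real (?N * (29 + 20 * L))" by (simp only: of_nat_le_iff)
  then have "real t \<le> real ?N * (29 + 20 * real L)" by simp
  \<comment> \<open>The ceiling adds less than 1 and \<open>?l\<close> is at least 1, whence the
    factor 2. Then \<open>29 + 40 * ?l\<close> is at most \<open>69 * ?l\<close>, within the
    constant 90.\<close>
  also have "real L \<le> 2 * ?l" using L by linarith
  then have "real ?N * (29 + 20 * real L) \<le> real ?N * (90 * ?l)" by (intro mult_left_mono) auto
  finally have "real t \<le> 90 * (real ?N * ?l)" by (simp only: ac_simps)
  moreover have "bicoloring_cover {..<n} E (run_colorings {..<n} hs L)"
    using k G H hs by (intro run_colorings_cover) (auto simp: L_def le_doublings)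
  moreover have "represents_bicolorings n M (run_colorings {..<n} hs L)"
    using M card by (intro represents_run_colorings)
  ultimately show ?thesis
    using run card L unfolding halts_with_def by (intro exI conjI) (assumption | simp)+
qed

theorem theorem3:
  shows "(\<forall>(V :: 'a set) E H k.
            k \<ge> 2 \<and> uniform_hypergraph k V E \<and> hitting_set V E H \<longrightarrow>
            int (bicoloring_cover_number V E)
              \<le> max 0 \<lceil>log 2 (real (card H) / (real k - 1))\<rceil> + 1)
       \<and> (\<exists>(p :: ram_prog) (c :: real).
            \<forall>n k E H xs.
              k \<ge> 2 \<and> uniform_hypergraph k {..<n} E \<and> hitting_set {..<n} E H \<and>
              encodes_instance n k E H xs \<longrightarrow>
              (\<exists>t M C. halts_with p xs t M \<and> represents_bicolorings n M C \<and>
                 bicoloring_cover {..<n} E C \<and>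
                 int (card C) = max 0 \<lceil>log 2 (real (card H) / (real k - 1))\<rceil> + 1 \<and>
                 real t \<le> c * (real (max 1 n) * max 1 (log 2 (real (card H) / (real k - 1))))))"
proof (rule conjI)
  show "\<forall>(V :: 'a set) E H k.
            k \<ge> 2 \<and> uniform_hypergraph k V E \<and> hitting_set V E H \<longrightarrow>
            int (bicoloring_cover_number V E)
              \<le> max 0 \<lceil>log 2 (real (card H) / (real k - 1))\<rceil> + 1"
    using bicoloring_cover_number_le by blast
next
  show "\<exists>(p :: ram_prog) (c :: real). \<forall>n k E H xs.
      k \<ge> 2 \<and> uniform_hypergraph k {..<n} E \<and> hitting_set {..<n} E H \<and>
      encodes_instance n k E H xs \<longrightarrow>
      (\<exists>t M C. halts_with p xs t M \<and> represents_bicolorings n M C \<and>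
         bicoloring_cover {..<n} E C \<and>
         int (card C) = max 0 \<lceil>log 2 (real (card H) / (real k - 1))\<rceil> + 1 \<and>
         real t \<le> c * (real (max 1 n) * max 1 (log 2 (real (card H) / (real k - 1)))))"
    using cover_prog_correct by blast
qed

end
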